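(* In the fully unobservable model of the stochastic clearing system in alternating environment, a dominant strategy always exists. Let $$V_{fu}=\frac{\lambda_1 q_{21}\mu_2+\lambda_2 q_{12}\mu_1}{(\lambda_1 q_{21}+\lambda_2 q_{12})(\mu_1\mu_2+\mu_1 q_{21}+\mu_2 q_{12})}+\frac{q_{21}+q_{12}}{\mu_1\mu_2+\mu_1 q_{21}+\mu_2 q_{12}}.$$ The dominant strategies are the following. (i) If $\frac{R}{C}<V_{fu}$, the dominant strategy is $q=0$ (always balk). (ii) If $\frac{R}{C}=V_{fu}$, every $q\in[0,1]$ is a dominant strategy. (iii) If $\frac{R}{C}>V_{fu}$, the dominant strategy is $q=1$ (always join).
   Context: Model. Parameters $\lambda_1,\lambda_2,\mu_1,\mu_2,q_{12},q_{21},R,C$ are positive reals. The environment $E(t)$ is a continuous-time Markov chain on $\{1,2\}$ with transition rate $q_{12}$ from 1 to 2 and $q_{21}$ from 2 to 1. While the environment is in state $e$, customers arrive according to a Poisson process of rate $\lambda_e$ and, independently, a facility visits according to a Poisson process of rate $\mu_e$; at each visit all present customers are served instantaneously and removed. A customer who joins receives reward $R$ and pays cost $C$ per unit of time spent in the system; a customer who balks gets $0$. Decisions are irrevocable. Fully unobservable case. An arriving customer observes neither the number of customers nor the environment. A strategy is a joining probability $q\in[0,1]$. The system is in steady state: an arriving customer finds the environment in state $e$ with probability $\frac{\lambda_e p_E(e)}{\lambda_1p_E(1)+\lambda_2p_E(2)}$, where $p_E(1)=\frac{q_{21}}{q_{12}+q_{21}}$, $p_E(2)=\frac{q_{12}}{q_{12}+q_{21}}$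 is the stationary distribution of the environment. The sojourn time of a customer who joins when the environment is $e$ is the time $S_e$ until the next visit of the facility, i.e. the first point of the visit process (intensity $\mu_{E(t)}$) when $E(0)=e$. The payoff $\mathcal U(q,q')$ of a tagged customer using $q$ when all others use $q'$ is $$\mathcal U(q,q')=q\sum_{e=1}^{2}\frac{\lambda_e p_E(e)}{\lambda_1p_E(1)+\lambda_2p_E(2)}\bigl(R-C\,\mathbb E[S_e]\bigr).$$ A strategy $s_*$ is dominant if $\mathcal U(s_*,s)\ge\mathcal U(s',s)$ for all strategies $s',s$. *)

theory Defs
  imports "HOL-Probability.Probability"
begin

section \<open>The environment and the visits of the facility\<close>

definition other_env :: "nat \<Rightarrow> nat" where
  "other_env e = (if e = 1 then 2 else 1)"

definition exit_rate :: "real \<Rightarrow> real \<Rightarrow> nat \<Rightarrow> real" where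
  "exit_rate q12 q21 e = (if e = 1 then q12 else q21)"

text \<open>
  The continuous-time Markov chain on \<open>{1, 2}\<close> with rates \<open>q12\<close> and \<open>q21\<close>, started in \<open>e\<close>, in its
  jump chain/holding time description: with two states the jump chain alternates deterministically,
  so \<open>(other_env ^^ n) e\<close> is the state after \<open>n\<close> jumps, and \<open>H n\<close> is the time spent there.
  Since the holding times have infinite sum almost surely, \<open>E\<close> is determined at all times
  \<open>t \<ge> 0\<close>; its values at negative times play no role.
\<close>

definition alternating_environment ::
    "'a measure \<Rightarrow> real \<Rightarrow> real \<Rightarrow> nat \<Rightarrow> (real \<Rightarrow> 'a \<Rightarrow> nat) \<Rightarrow> bool" where
  "alternating_environment M q12 q21 e E \<longleftrightarrow>
     (\<forall>t\<ge>0. E t \<in> measurable M (count_space UNIV)) \<and>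
     (\<exists>H :: nat \<Rightarrow> 'a \<Rightarrow> real.
        prob_space.indep_vars M (\<lambda>_. borel) H UNIV \<and>
        (\<forall>n. distributed M lborel (H n)
               (\<lambda>x. ennreal (exponential_density (exit_rate q12 q21 ((other_env ^^ n) e)) x))) \<and>
        (AE \<omega> in M. \<forall>n. \<forall>t\<ge>0. (\<Sum>k<n. H k \<omega>) \<le> t \<and> t < (\<Sum>k<Suc n. H k \<omega>) \<longrightarrow>
               E t \<omega> = (other_env ^^ n) e))"

text \<open>The \<open>\<sigma>\<close>-algebra generated by the whole environment path \<open>(E t)\<close>, \<open>t \<ge> 0\<close>.\<close>

definition path_algebra :: "'a measure \<Rightarrow> (real \<Rightarrow> 'a \<Rightarrow> nat) \<Rightarrow> 'a measure" where
  "path_algebra M E = sigma (space M) {E t -` A \<inter> space M | t A. 0 \<le> t}"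

definition cumulative_intensity ::
    "(nat \<Rightarrow> real) \<Rightarrow> (real \<Rightarrow> 'a \<Rightarrow> nat) \<Rightarrow> real \<Rightarrow> real \<Rightarrow> 'a \<Rightarrow> real" where
  "cumulative_intensity \<mu> E s t \<omega> = set_lebesgue_integral lborel {s..t} (\<lambda>u. \<mu> (E u \<omega>))"

text \<open>
  \<open>N t\<close> is the number of visits in \<open>(0, t]\<close>. The visit process has intensity \<open>\<mu> (E t)\<close>: given the
  environment path, it is a Poisson process with this time-dependent rate, that is, the numbers of
  visits in disjoint intervals are conditionally independent and Poisson distributed, with the
  cumulative intensity of the interval as mean.
\<close>

locale visit_process = prob_space M
  for M :: "'a measure" and q12 q21 :: real and \<mu> :: "nat \<Rightarrow> real" and e :: nat
    and E :: "real \<Rightarrow> 'a \<Rightarrow> nat" and N :: "real \<Rightarrow> 'a \<Rightarrow> nat" +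
  assumes environment: "alternating_environment M q12 q21 e E"
    and visits_measurable: "\<And>t. 0 \<le> t \<Longrightarrow> N t \<in> measurable M (count_space UNIV)"
    and visits_path: "AE \<omega> in M. N 0 \<omega> = 0 \<and>
          (\<forall>s t. 0 \<le> s \<and> s \<le> t \<longrightarrow> N s \<omega> \<le> N t \<omega>) \<and>
          (\<forall>t\<ge>0. continuous (at_right t) (\<lambda>s. N s \<omega>))"
    and visits_given_environment:
      "\<And>(n::nat) (t :: nat \<Rightarrow> real) (k :: nat \<Rightarrow> nat).
         0 \<le> t 0 \<Longrightarrow> (\<And>i. i < n \<Longrightarrow> t i < t (Suc i)) \<Longrightarrow>
         AE \<omega> in M.
           real_cond_exp M (path_algebra M E)
             (indicator {\<omega> \<in> space M. \<forall>i<n. N (t (Suc i)) \<omega> = N (t i) \<omega> + k i}) \<omega>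
           = (\<Prod>i<n. pmf (poisson_pmf (cumulative_intensity \<mu> E (t i) (t (Suc i)) \<omega>)) (k i))"

text \<open>
  The first point of the visit process, \<open>\<infinity>\<close> if there is none. The mean is in fact finite for
  positive rates, so that the conversion by \<^const>\<open>enn2real\<close> does not lose anything.
\<close>

definition sojourn_time :: "(real \<Rightarrow> 'a \<Rightarrow> nat) \<Rightarrow> 'a \<Rightarrow> ennreal" where
  "sojourn_time N \<omega> = (INF t\<in>{t. 0 < t \<and> 0 < N t \<omega>}. ennreal t)"

definition mean_sojourn_time :: "'a measure \<Rightarrow> (real \<Rightarrow> 'a \<Rightarrow> nat) \<Rightarrow> real" where
  "mean_sojourn_time M N = enn2real (\<integral>\<^sup>+ \<omega>. sojourn_time N \<omega> \<partial>M)"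

section \<open>The joining game in the fully unobservable case\<close>

definition p_env :: "real \<Rightarrow> real \<Rightarrow> nat \<Rightarrow> real" where
  "p_env q12 q21 e = (if e = 1 then q21 / (q12 + q21) else q12 / (q12 + q21))"

lemma p_env_stationary:
  assumes "q12 > 0" "q21 > 0"
  shows "p_env q12 q21 1 * q12 = p_env q12 q21 2 * q21"
    and "p_env q12 q21 1 + p_env q12 q21 2 = 1"
  using assms by (simp_all add: p_env_def flip: add_divide_distrib)

definition p_arrival :: "(nat \<Rightarrow> real) \<Rightarrow> real \<Rightarrow> real \<Rightarrow> nat \<Rightarrow> real" where
  "p_arrival lam q12 q21 e =
     lam e * p_env q12 q21 e / (lam 1 * p_env q12 q21 1 + lam 2 * p_env q12 q21 2)"

text \<open>
  \<open>payoff lam q12 q21 R C ES q q'\<close> is the payoff of a tagged customer who joins with probability \<open>q\<close>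
  when all others join with probability \<open>q'\<close>, where \<open>ES e\<close> is the mean sojourn time of a customer
  joining in environment \<open>e\<close>. All present customers are served at each visit, hence \<open>q'\<close> does not
  occur on the right-hand side.
\<close>

definition payoff ::
    "(nat \<Rightarrow> real) \<Rightarrow> real \<Rightarrow> real \<Rightarrow> real \<Rightarrow> real \<Rightarrow> (nat \<Rightarrow> real) \<Rightarrow> real \<Rightarrow> real \<Rightarrow> real" where
  "payoff lam q12 q21 R C ES q q' = q * (\<Sum>e\<in>{1, 2}. p_arrival lam q12 q21 e * (R - C * ES e))"

definition dominant :: "(real \<Rightarrow> real \<Rightarrow> real) \<Rightarrow> real \<Rightarrow> bool" where
  "dominant U s \<longleftrightarrow> s \<in> {0..1} \<and> (\<forall>s'\<in>{0..1}. \<forall>r\<in>{0..1}. U s r \<ge> U s' r)"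

definition V_fu :: "(nat \<Rightarrow> real) \<Rightarrow> (nat \<Rightarrow> real) \<Rightarrow> real \<Rightarrow> real \<Rightarrow> real" where
  "V_fu lam \<mu> q12 q21 =
     (lam 1 * q21 * \<mu> 2 + lam 2 * q12 * \<mu> 1) /
       ((lam 1 * q21 + lam 2 * q12) * (\<mu> 1 * \<mu> 2 + \<mu> 1 * q21 + \<mu> 2 * q12)) +
     (q21 + q12) / (\<mu> 1 * \<mu> 2 + \<mu> 1 * q21 + \<mu> 2 * q12)"

end

theory Submission
  imports Defs
begin

text \<open>
  Other customers never delay a tagged customer, so the payoff is \<open>q\<close> times a constant, and dominance
  only depends on the sign of that constant. Up to a positive factor \<open>C\<close> it is \<open>R / C\<close> minus the mean
  sojourn time averaged over the environment found on arrival. Once the means are known, \<open>V_fu\<close> is seen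
  to be this average by clearing denominators, so everything rests on computing
  \<open>m e = E[S e]\<close>, the mean time until the first visit when the environment starts in \<open>e\<close>.

  Conditioning on the first event gives \<open>(r e + \<mu> e) * m e = 1 + r e * m e'\<close>, where \<open>r e\<close> is the rate of
  leaving \<open>e\<close> and \<open>e'\<close> is the other state; the solution is
  \<open>m e = (\<mu> e' + q12 + q21) / (\<mu> 1 * \<mu> 2 + \<mu> 1 * q21 + \<mu> 2 * q12)\<close>. The visit process is given through its
  conditional law given the environment path and not as a Markov process, so instead of a renewal
  argument the proof sums over the holding times of the environment:

  \<^item> The mean is the integral over \<open>t\<close> of the probability of no visit up to \<open>t\<close>, and that probability is
    the expectation of \<open>exp (- \<Lambda> t)\<close>, where \<open>\<Lambda> t\<close> is the cumulative intensity
    (lemmas \<open>nn_integral_sojourn_time\<close> and \<open>emeasure_no_visit\<close>).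

  \<^item> On a fixed environment path with holding times \<open>h k\<close> and visit rates \<open>a k\<close>, \<open>\<Lambda>\<close> is piecewise linear.
    With \<open>X n = exp (- (\<Sum>k<n. a k * h k))\<close>, the integral of \<open>exp (- \<Lambda> t)\<close> over the \<open>n\<close>-th holding time is
    \<open>(X n - X (Suc n)) / a n\<close> (locale \<open>sojourn_path\<close>).

  \<^item> The holding times are independent and exponential with rates \<open>r k\<close>, so the expectation of \<open>X n\<close> is
    \<open>P n = (\<Prod>k<n. r k / (r k + a k))\<close>, and the mean is the sum over \<open>n\<close> of \<open>P n / (r n + a n)\<close>
    (lemmas \<open>laplace_sum\<close> and \<open>nn_integral_sojourn_time_suminf\<close>).

  \<^item> By the first-step equation each term of this series is \<open>P n * m (e n) - P (Suc n) * m (e (Suc n))\<close>,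
    where \<open>e n\<close> is the \<open>n\<close>-th state visited, so the series telescopes to \<open>m e\<close>
    (lemma \<open>mean_sojourn_time_eq\<close>).
\<close>

section \<open>Integrals over paths\<close>

text \<open>
  The layer-cake formula for a single value; Fubini turns it into the tail formula for a mean.
\<close>

lemma nn_integral_ennreal_below:
  "(\<integral>\<^sup>+ t. indicator {t. 0 < t \<and> ennreal t < x} t \<partial>lborel) = x"
proof (cases x)
  case (real r)
  have "{t. 0 < t \<and> ennreal t < x} = {0<..<r}"
    using real by (auto simp: ennreal_less_iff)
  then show ?thesis using real by simp
next
  case top
  have "{t. 0 < t \<and> ennreal t < x} = {0<..}"
    using top by (auto simp: less_top)
  moreover have "of_nat n \<le> emeasure lborel {0::real<..}" for n
  proof -
    have "of_nat n = emeasure lborel {0<..<real n}" by (simp add: ennreal_of_nat_eq_real_of_nat)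
    also have "\<dots> \<le> emeasure lborel {0::real<..}" by (intro emeasure_mono) auto
    finally show ?thesis .
  qed
  then have "(SUP n. of_nat n) \<le> emeasure lborel {0::real<..}" by (intro SUP_least)
  then have "emeasure lborel {0::real<..} = \<top>"
    by (simp add: ennreal_SUP_of_nat_eq_top top_unique)
  ultimately show ?thesis using top by simp
qed

text \<open>
  One realisation of the environment seen through the visit rate: \<open>f\<close> is a step function with value
  \<open>a n\<close> during the \<open>n\<close>-th holding time \<open>h n\<close>. Unboundedness of the jump times says that there are only
  finitely many jumps in bounded time, so that \<open>f\<close> is determined on the whole half-line.
\<close>

locale sojourn_path =
  fixes h :: "nat \<Rightarrow> real" and f :: "real \<Rightarrow> real" and a :: "nat \<Rightarrow> real"
  assumes h_pos: "\<And>k. 0 < h k" and a_pos: "\<And>k. 0 < a k"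
    and unbounded: "\<And>t. \<exists>n. t < (\<Sum>k<n. h k)"
    and step: "\<And>n u. 0 \<le> u \<Longrightarrow> (\<Sum>k<n. h k) \<le> u \<Longrightarrow> u < (\<Sum>k<Suc n. h k) \<Longrightarrow> f u = a n"
begin

definition T where "T n = (\<Sum>k<n. h k)"

lemma T_Suc: "T (Suc n) = T n + h n"
  by (simp add: T_def)

lemma T_nonneg: "0 \<le> T n"
  unfolding T_def by (intro sum_nonneg less_imp_le h_pos)

lemma integral_upto_T:
  "has_bochner_integral lborel (\<lambda>u. indicator {0..<T n} u *\<^sub>R f u) (\<Sum>k<n. a k * h k)"
proof (induction n)
  case 0
  then show ?case by (simp add: T_def has_bochner_integral_zero)
next
  case (Suc n)
  have "has_bochner_integral lborel (\<lambda>u. indicator {T n..<T (Suc n)} u *\<^sub>R a n)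
     (measure lborel {T n..<T (Suc n)} *\<^sub>R a n)"
    by (intro has_bochner_integral_scaleR_left has_bochner_integral_real_indicator) (auto simp: T_Suc less_imp_le[OF h_pos])
  also have "measure lborel {T n..<T (Suc n)} *\<^sub>R a n = a n * h n"
    using h_pos[of n] by (simp add: T_Suc)
  finally have "has_bochner_integral lborel
      (\<lambda>u. indicator {0..<T n} u *\<^sub>R f u + indicator {T n..<T (Suc n)} u *\<^sub>R a n)
      ((\<Sum>k<n. a k * h k) + a n * h n)"
    by (intro has_bochner_integral_add Suc.IH)
  also have "(\<lambda>u. indicator {0..<T n} u *\<^sub>R f u + indicator {T n..<T (Suc n)} u *\<^sub>R a n)
      = (\<lambda>u. indicator {0..<T (Suc n)} u *\<^sub>R f u)"
    using T_nonneg[of n] h_pos[of n] step[of _ n, folded T_def]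
    by (auto simp: fun_eq_iff indicator_def T_Suc)
  finally show ?case by (simp add: add.commute)
qed

lemma integral_upto:
  assumes "T n \<le> t" "t < T (Suc n)"
  shows "set_lebesgue_integral lborel {0..t} f = (\<Sum>k<n. a k * h k) + a n * (t - T n)"
proof -
  have "has_bochner_integral lborel (\<lambda>u. indicator {T n..t} u *\<^sub>R a n)
     (measure lborel {T n..t} *\<^sub>R a n)"
    by (intro has_bochner_integral_scaleR_left has_bochner_integral_real_indicator) (use assms in auto)
  then have "has_bochner_integral lborel
      (\<lambda>u. indicator {0..<T n} u *\<^sub>R f u + indicator {T n..t} u *\<^sub>R a n)
      ((\<Sum>k<n. a k * h k) + measure lborel {T n..t} *\<^sub>R a n)"
    by (intro has_bochner_integral_add integral_upto_T)
  also have "(\<lambda>u. indicator {0..<T n} u *\<^sub>R f u + indicator {T n..t} u *\<^sub>R a n)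
      = (\<lambda>u. indicator {0..t} u *\<^sub>R f u)"
    using T_nonneg[of n] step[of _ n, folded T_def] assms
    by (auto simp: fun_eq_iff indicator_def T_Suc)
  finally show ?thesis
    using assms by (simp add: set_lebesgue_integral_def has_bochner_integral_integral_eq mult.commute)
qed

lemma ex1_interval:
  assumes "0 \<le> t"
  shows "\<exists>n. T n \<le> t \<and> t < T (Suc n)"
proof -
  define m where "m = (LEAST n. t < T n)"
  have "\<exists>n. t < T n" using unbounded[of t] by (simp add: T_def)
  then have m: "t < T m" unfolding m_def by (rule LeastI_ex)
  with assms obtain n where n: "m = Suc n" by (cases m) (auto simp: T_def)
  have "\<not> t < T n" using not_less_Least[of n "\<lambda>n. t < T n"] n by (simp add: m_def)
  with m n have "T n \<le> t \<and> t < T (Suc n)" by simp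
  then show ?thesis ..
qed

lemma strict_mono_T: "strict_mono T"
  by (rule strict_monoI_Suc) (simp add: T_Suc h_pos)

lemma interval_unique:
  assumes "T n \<le> t" "t < T (Suc n)" "T m \<le> t" "t < T (Suc m)"
  shows "m = n"
proof -
  have "n < Suc m" "m < Suc n"
    using assms strict_mono_less[OF strict_mono_T] by (metis le_less_trans)+
  then show ?thesis by simp
qed

text \<open>
  Poisson distributions are only specified for positive parameters, hence the strict inequality.
\<close>

lemma integral_pos:
  assumes "0 < t"
  shows "0 < set_lebesgue_integral lborel {0..t} f"
proof -
  obtain n where n: "T n \<le> t" "t < T (Suc n)"
    using ex1_interval[of t] assms by auto
  show ?thesis
  proof (cases n)
    case 0
    then show ?thesis using n assms a_pos[of 0] by (simp add: integral_upto[OF n] T_def)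
  next
    case (Suc m)
    then have "0 < (\<Sum>k<n. a k * h k)"
      by (intro sum_pos) (auto intro: mult_pos_pos a_pos h_pos)
    moreover have "0 \<le> a n * (t - T n)"
      using n a_pos[of n] by simp
    ultimately show ?thesis by (simp add: integral_upto[OF n])
  qed
qed

text \<open>
  Exactly one summand is nonzero, the one of the holding time that contains \<open>t\<close>. In this form the
  conditional probability of no visit is jointly measurable in \<open>t\<close> and the path.
\<close>

lemma exp_integral_eq_suminf:
  assumes "0 \<le> t"
  shows "ennreal (exp (- set_lebesgue_integral lborel {0..t} f)) =
    (\<Sum>n. ennreal (exp (- ((\<Sum>k<n. a k * h k) + a n * (t - T n)))) * indicator {T n..<T (Suc n)} t)"
    (is "_ = (\<Sum>n. ?g n)")
proof -
  obtain n where n: "T n \<le> t" "t < T (Suc n)"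
    using ex1_interval assms by auto
  have "(\<Sum>n. ?g n) = (\<Sum>m\<in>{n}. ?g m)"
    using interval_unique[OF n] by (intro suminf_finite) (auto simp: indicator_def)
  then show ?thesis using n by (simp add: integral_upto[OF n])
qed

end

lemma nn_integral_exp_interval:
  fixes a b s h :: real
  assumes "0 < a" "0 \<le> h"
  shows "(\<integral>\<^sup>+ t. ennreal (exp (- (b + a * (t - s)))) * indicator {s..<s + h} t \<partial>lborel)
    = ennreal ((exp (- b) - exp (- (b + a * h))) / a)"
proof -
  have "(\<integral>\<^sup>+ t. ennreal (exp (- (b + a * (t - s)))) * indicator {s..<s + h} t \<partial>lborel)
     = (\<integral>\<^sup>+ t. ennreal (exp (- (b + a * (t - s)))) * indicator {s..s + h} t \<partial>lborel)"
    using AE_lborel_singleton[of "s + h"]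
    by (intro nn_integral_cong_AE) (auto elim!: eventually_mono simp: indicator_def)
  \<comment> \<open>an antiderivative of the integrand is \<open>- exp (- (b + a * (t - s))) / a\<close>\<close>
  also have "\<dots> = ennreal (- exp (- (b + a * (s + h - s))) / a - - exp (- (b + a * (s - s))) / a)"
  proof (intro nn_integral_FTC_Icc)
    fix x
    show "((\<lambda>t. - exp (- (b + a * (t - s))) / a) has_real_derivative exp (- (b + a * (x - s)))) (at x)"
      using assms by (auto intro!: derivative_eq_intros)
  qed (use assms in auto)
  also have "\<dots> = ennreal ((exp (- b) - exp (- (b + a * h))) / a)"
    by (simp add: diff_divide_distrib)
  finally show ?thesis .
qed

section \<open>Independent exponential holding times\<close>

locale exponential_holding_times = prob_space M
  for M :: "'a measure" +
  fixes H :: "nat \<Rightarrow> 'a \<Rightarrow> real" and rate :: "nat \<Rightarrow> real"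
  assumes indep: "indep_vars (\<lambda>_. borel) H UNIV"
    and exponential: "\<And>n. distributed M lborel (H n) (\<lambda>x. ennreal (exponential_density (rate n) x))"
    and rate_pos: "\<And>n. 0 < rate n"
begin

lemma measurable_H [measurable]: "H n \<in> borel_measurable M"
  using distributed_measurable[OF exponential[of n]] by simp

lemma AE_H_pos: "AE \<omega> in M. \<forall>n. 0 < H n \<omega>"
proof (subst AE_all_countable, intro allI)
  fix n
  have "AE x in lborel. 0 < ennreal (exponential_density (rate n) x) \<longrightarrow> 0 < x"
    using AE_lborel_singleton[of "0::real"]
    by eventually_elim (auto simp: exponential_density_def not_less)
  then show "AE \<omega> in M. 0 < H n \<omega>"
    by (subst distributed_AE2[OF exponential[of n]]) auto
qed

lemma laplace_holding_time:
  assumes "0 \<le> a"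
  shows "(\<integral>\<^sup>+ \<omega>. ennreal (exp (- (a * H n \<omega>))) \<partial>M) = ennreal (rate n / (rate n + a))"
proof -
  have l: "0 < rate n + a" using rate_pos[of n] assms by simp
  have "(\<integral>\<^sup>+ \<omega>. ennreal (exp (- (a * H n \<omega>))) \<partial>M)
      = (\<integral>\<^sup>+ x. ennreal (exponential_density (rate n) x) * ennreal (exp (- (a * x))) \<partial>lborel)"
    by (intro distributed_nn_integral[OF exponential, symmetric]) auto
  \<comment> \<open>exponential tilting: the weighted density is a multiple of another exponential density\<close>
  also have "\<dots> = (\<integral>\<^sup>+ x. ennreal (rate n / (rate n + a)) *
                     ennreal (exponential_density (rate n + a) x) \<partial>lborel)"
  proof (intro nn_integral_cong)
    fix x
    have "exponential_density (rate n) x * exp (- (a * x))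
        = rate n / (rate n + a) * exponential_density (rate n + a) x"
      using l by (simp add: exponential_density_def mult_exp_exp divide_simps) (simp add: algebra_simps)
    then show "ennreal (exponential_density (rate n) x) * ennreal (exp (- (a * x)))
        = ennreal (rate n / (rate n + a)) * ennreal (exponential_density (rate n + a) x)"
      using l rate_pos[of n] by (simp flip: ennreal_mult' add: exponential_density_nonneg)
  qed
  also have "\<dots> = ennreal (rate n / (rate n + a))"
    using nn_integral_erlang_ith_moment[OF l, of 0 0] by (simp add: nn_integral_cmult)
  finally show ?thesis .
qed

lemma laplace_sum:
  assumes "\<And>k. 0 \<le> a k"
  shows "(\<integral>\<^sup>+ \<omega>. ennreal (exp (- (\<Sum>k<n. a k * H k \<omega>))) \<partial>M) = ennreal (\<Prod>k<n. rate k / (rate k + a k))"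
proof -
  have "indep_vars (\<lambda>_. borel) (\<lambda>k \<omega>. ennreal (exp (- (a k * H k \<omega>)))) {..<n}"
    by (rule indep_vars_compose2[where M' = "\<lambda>_. borel", OF indep_vars_subset[OF indep]]) auto
  then have "(\<integral>\<^sup>+ \<omega>. (\<Prod>k<n. ennreal (exp (- (a k * H k \<omega>)))) \<partial>M)
      = (\<Prod>k<n. \<integral>\<^sup>+ \<omega>. ennreal (exp (- (a k * H k \<omega>))) \<partial>M)"
    by (intro indep_vars_nn_integral) auto
  then show ?thesis
    using assms rate_pos
    by (simp add: laplace_holding_time prod_ennreal exp_sum sum_negf[symmetric] add_nonneg_nonneg less_imp_le)
qed

text \<open>
  With \<open>T n\<close> the sum of the first \<open>n\<close> holding times, the mean of \<open>exp (- T n)\<close> is at most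
  \<open>(c / (c + 1)) ^ n\<close>. Hence the infimum of these variables has mean zero and vanishes almost surely,
  which means that \<open>T n\<close> takes arbitrarily large values: the environment does not explode.
\<close>

lemma AE_unbounded:
  assumes "\<And>k. rate k \<le> c"
  shows "AE \<omega> in M. \<forall>t. \<exists>n. t < (\<Sum>k<n. H k \<omega>)"
proof -
  define X where "X n \<omega> = ennreal (exp (- (\<Sum>k<n. H k \<omega>)))" for n \<omega>
  have [measurable]: "X n \<in> borel_measurable M" for n unfolding X_def by measurable
  have c: "0 < c" using assms[of 0] rate_pos[of 0] by simp
  have "(\<integral>\<^sup>+ \<omega>. (INF n. X n \<omega>) \<partial>M) \<le> ennreal ((c / (c + 1)) ^ n)" for n
  proof -
    have "(\<integral>\<^sup>+ \<omega>. (INF n. X n \<omega>) \<partial>M) \<le> (\<integral>\<^sup>+ \<omega>. X n \<omega> \<partial>M)"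
      by (intro nn_integral_mono INF_lower) auto
    also have "\<dots> = ennreal (\<Prod>k<n. rate k / (rate k + 1))"
      using laplace_sum[of "\<lambda>_. 1" n] by (simp add: X_def)
    also have "(\<Prod>k<n. rate k / (rate k + 1)) \<le> (\<Prod>k<n. c / (c + 1))"
      using rate_pos assms c
      by (intro prod_mono) (auto simp: frac_le_eq field_simps less_imp_le add_pos_pos divide_simps)
    finally show ?thesis by (simp add: ennreal_leI)
  qed
  moreover have "(\<lambda>n. ennreal ((c / (c + 1)) ^ n)) \<longlonglongrightarrow> ennreal 0"
    using c by (intro tendsto_ennrealI LIMSEQ_power_zero) auto
  ultimately have "(\<integral>\<^sup>+ \<omega>. (INF n. X n \<omega>) \<partial>M) \<le> ennreal 0"
    by (intro LIMSEQ_le_const) auto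
  then have "AE \<omega> in M. (INF n. X n \<omega>) = 0"
    by (subst (asm) ennreal_0, subst nn_integral_0_iff_AE[symmetric]) auto
  then show ?thesis
  proof eventually_elim
    case (elim \<omega>)
    show ?case
    proof
      fix t
      have "(INF n. X n \<omega>) < ennreal (exp (- t))" using elim by simp
      then obtain n where "X n \<omega> < ennreal (exp (- t))" by (auto simp: INF_less_iff)
      then show "\<exists>n. t < (\<Sum>k<n. H k \<omega>)" by (auto simp: X_def ennreal_less_iff)
    qed
  qed
qed

text \<open>
  Only the means \<open>P n\<close> of the exponentials enter: \<open>P n - P (Suc n) = P n * a n / (rate n + a n)\<close>.
\<close>

lemma expected_increment:
  assumes "\<And>k. 0 < a k"
  shows "(\<integral>\<^sup>+ \<omega>. ennreal ((exp (- (\<Sum>k<n. a k * H k \<omega>)) - exp (- (\<Sum>k<Suc n. a k * H k \<omega>))) / a n) \<partial>M)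
    = ennreal ((\<Prod>k<n. rate k / (rate k + a k)) / (rate n + a n))"
proof -
  define P where "P n = (\<Prod>k<n. rate k / (rate k + a k))" for n
  define X where "X n \<omega> = exp (- (\<Sum>k<n. a k * H k \<omega>))" for n \<omega>
  have [measurable]: "X n \<in> borel_measurable M" for n unfolding X_def by measurable
  have P_nonneg: "0 \<le> P n" for n
    unfolding P_def using rate_pos assms by (intro prod_nonneg) (simp add: add_nonneg_nonneg less_imp_le)
  have X: "(\<integral>\<^sup>+ \<omega>. ennreal (X n \<omega>) \<partial>M) = ennreal (P n)" for n
    using laplace_sum[of a n] assms by (simp add: X_def P_def less_imp_le)
  have hbi: "has_bochner_integral M (X n) (P n)" for n
    using X[of n] P_nonneg by (intro has_bochner_integral_nn_integral) (auto simp: X_def)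
  have inc: "has_bochner_integral M (\<lambda>\<omega>. (X n \<omega> - X (Suc n) \<omega>) / a n) ((P n - P (Suc n)) / a n)"
    by (intro has_bochner_integral_divide_zero has_bochner_integral_diff hbi)
  have "AE \<omega> in M. 0 \<le> (X n \<omega> - X (Suc n) \<omega>) / a n"
    using AE_H_pos
    by eventually_elim
       (use assms[of n] in \<open>auto simp: X_def intro!: divide_nonneg_pos mult_nonneg_nonneg less_imp_le\<close>)
  from nn_integral_eq_integral[OF integrable.intros[OF inc] this]
  have "(\<integral>\<^sup>+ \<omega>. ennreal ((X n \<omega> - X (Suc n) \<omega>) / a n) \<partial>M) = ennreal ((P n - P (Suc n)) / a n)"
    by (simp only: has_bochner_integral_integral_eq[OF inc])
  also have "(P n - P (Suc n)) / a n = P n / (rate n + a n)"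
  proof -
    have "P (Suc n) = P n * (rate n / (rate n + a n))" by (simp add: P_def)
    moreover have "(p - p * (r / (r + x))) / x = p / (r + x)" if "0 < r" "0 < x" for p r x :: real
      using that by (simp add: divide_simps add_pos_pos) (simp add: algebra_simps)
    ultimately show ?thesis using rate_pos assms by simp
  qed
  finally show ?thesis by (simp add: X_def P_def)
qed

end

section \<open>The mean time until the first visit\<close>

lemma other_env_funpow: "e \<in> {1, 2} \<Longrightarrow> (other_env ^^ n) e \<in> {1, 2}"
  by (induction n) (auto simp: other_env_def)

text \<open>
  An infimum over uncountably many times need not be measurable. Once \<open>N\<close> has a visit it keeps it, so
  the rational times suffice.
\<close>

lemma sojourn_time_rational:
  assumes mono: "\<And>s t. 0 \<le> s \<Longrightarrow> s \<le> t \<Longrightarrow> N s \<omega> \<le> N t \<omega>"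
  shows "sojourn_time N \<omega> = (INF r\<in>{r\<in>\<rat>. 0 < r}. if 0 < N r \<omega> then ennreal r else \<top>)"
    (is "_ = ?S")
proof (rule antisym)
  show "sojourn_time N \<omega> \<le> ?S"
    unfolding sojourn_time_def by (intro INF_greatest) (auto intro: INF_lower)
  show "?S \<le> sojourn_time N \<omega>"
    unfolding sojourn_time_def
  proof (intro INF_greatest)
    fix t assume t: "t \<in> {t. 0 < t \<and> 0 < N t \<omega>}"
    show "?S \<le> ennreal t"
    proof (rule ccontr)
      assume "\<not> ?S \<le> ennreal t"
      then obtain x where x: "ennreal t < x" "x < ?S"
        using dense by (auto simp: not_le)
      then obtain b where b: "x = ennreal b" "0 \<le> b" by (cases x) auto
      with x t have "t < b" by (simp add: ennreal_less_iff)
      then obtain r where r: "r \<in> \<rat>" "t < r" "r < b" using Rats_dense_in_real by blast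
      with t have "0 < N r \<omega>" using mono[of t r] by auto
      with r t have "?S \<le> ennreal r" by (intro INF_lower2[of r]) auto
      also have "ennreal r < x" using b r t by (simp add: ennreal_less_iff)
      finally show False using x by simp
    qed
  qed
qed

text \<open>
  Right-continuity enters because \<open>N\<close> is integer-valued: it stays constant for a while after \<open>t\<close>, which
  makes the inequality strict.
\<close>

lemma less_sojourn_time_iff:
  assumes mono: "\<And>s t. 0 \<le> s \<Longrightarrow> s \<le> t \<Longrightarrow> N s \<omega> \<le> N t \<omega>"
    and cont: "continuous (at_right t) (\<lambda>s. N s \<omega>)" and t: "0 < t"
  shows "ennreal t < sojourn_time N \<omega> \<longleftrightarrow> N t \<omega> = 0"
proof
  assume "ennreal t < sojourn_time N \<omega>"
  then show "N t \<omega> = 0"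
    using t unfolding sojourn_time_def by (auto dest!: less_INF_D[where i = t])
next
  assume N: "N t \<omega> = 0"
  have "eventually (\<lambda>s. N s \<omega> = N t \<omega>) (at_right t)"
    using cont by (simp add: continuous_within tendsto_discrete)
  then obtain b where b: "t < b" "\<And>s. t < s \<Longrightarrow> s < b \<Longrightarrow> N s \<omega> = 0"
    using N by (auto simp: eventually_at_right_field)
  define c where "c = (t + b) / 2"
  have c: "t < c" "c < b" using b by (auto simp: c_def)
  have "ennreal c \<le> sojourn_time N \<omega>"
    unfolding sojourn_time_def
  proof (intro INF_greatest ennreal_leI)
    fix s assume s: "s \<in> {t. 0 < t \<and> 0 < N t \<omega>}"
    show "c \<le> s"
    proof (rule ccontr)
      assume "\<not> c \<le> s"
      then have "N s \<omega> \<le> N c \<omega>" using s by (intro mono) auto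
      with s b(2)[OF c] show False by simp
    qed
  qed
  then show "ennreal t < sojourn_time N \<omega>"
    using c t by (intro less_le_trans[OF _ \<open>ennreal c \<le> _\<close>]) (simp add: ennreal_less_iff)
qed

context visit_process
begin

lemma measurable_N [measurable]: "0 \<le> t \<Longrightarrow> N t \<in> measurable M (count_space UNIV)"
  by (rule visits_measurable)

lemma measurable_E: "0 \<le> t \<Longrightarrow> E t \<in> measurable M (count_space UNIV)"
  using environment by (simp add: alternating_environment_def)

lemma path_subalgebra: "finite_measure_subalgebra M (path_algebra M E)"
proof
  let ?G = "{E t -` A \<inter> space M | t A. 0 \<le> t}"
  have G: "?G \<subseteq> Pow (space M)" by auto
  have "?G \<subseteq> sets M"
    using measurable_sets[OF measurable_E] by auto
  then have "sigma_sets (space M) ?G \<subseteq> sets M"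
    by (rule sets.sigma_sets_subset)
  then show "subalgebra M (path_algebra M E)"
    using G by (simp add: subalgebra_def path_algebra_def space_measure_of sets_measure_of)
qed

text \<open>
  The single increment over \<open>(0, t]\<close> vanishes with the conditional probability that the Poisson law with
  mean \<open>\<Lambda> t\<close> gives to zero; averaging removes the conditioning.
  The right-hand side is a nonnegative integral because such an integral only depends on the
  integrand up to null sets even where measurability of the integrand is unknown.
\<close>

lemma emeasure_no_visit:
  assumes "0 < t"
  shows "emeasure M {\<omega> \<in> space M. N t \<omega> = 0}
    = (\<integral>\<^sup>+ \<omega>. ennreal (pmf (poisson_pmf (cumulative_intensity \<mu> E 0 t \<omega>)) 0) \<partial>M)"
proof -
  interpret F: finite_measure_subalgebra M "path_algebra M E" by (rule path_subalgebra)
  define A where "A = {\<omega> \<in> space M. N t \<omega> = N 0 \<omega>}"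
  have [measurable]: "N t \<in> measurable M (count_space UNIV)" "N 0 \<in> measurable M (count_space UNIV)"
    using assms by simp_all
  have "A = {\<omega> \<in> space M. real (N t \<omega>) = real (N 0 \<omega>)}" by (simp add: A_def)
  also have "\<dots> \<in> sets M" by measurable
  finally have A [measurable]: "A \<in> sets M" .
  have cond: "AE \<omega> in M. real_cond_exp M (path_algebra M E) (indicator A) \<omega>
      = pmf (poisson_pmf (cumulative_intensity \<mu> E 0 t \<omega>)) 0"
    using visits_given_environment[of "\<lambda>i. if i = 0 then 0 else t" 1 "\<lambda>_. 0"] assms
    by (simp add: A_def)
  have ind: "integrable M (indicator A :: _ \<Rightarrow> real)" by (simp add: emeasure_eq_measure)
  have "AE \<omega> in M. N 0 \<omega> = 0" using visits_path by auto
  then have "emeasure M {\<omega> \<in> space M. N t \<omega> = 0} = emeasure M A"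
    using A by (intro emeasure_eq_AE) (auto simp: A_def elim!: eventually_mono)
  also have "\<dots> = ennreal (\<integral>\<omega>. indicator A \<omega> \<partial>M)"
    by (simp add: emeasure_eq_measure)
  also have "\<dots> = ennreal (\<integral>\<omega>. real_cond_exp M (path_algebra M E) (indicator A) \<omega> \<partial>M)"
    using F.real_cond_exp_int(2)[OF ind] by simp
  also have "\<dots> = (\<integral>\<^sup>+ \<omega>. ennreal (real_cond_exp M (path_algebra M E) (indicator A) \<omega>) \<partial>M)"
    by (intro nn_integral_eq_integral[symmetric] F.real_cond_exp_int(1) F.real_cond_exp_pos ind) auto
  also have "\<dots> = (\<integral>\<^sup>+ \<omega>. ennreal (pmf (poisson_pmf (cumulative_intensity \<mu> E 0 t \<omega>)) 0) \<partial>M)"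
    using cond by (intro nn_integral_cong_AE) (auto elim!: eventually_mono)
  finally show ?thesis .
qed

text \<open>
  The tail formula for the mean. Fubini is applied to the measurable version \<open>S\<close> of the sojourn time,
  since \<open>N\<close> itself is only known to be measurable at each fixed time.
\<close>

lemma nn_integral_sojourn_time:
  "(\<integral>\<^sup>+ \<omega>. sojourn_time N \<omega> \<partial>M)
    = (\<integral>\<^sup>+ t. emeasure M {\<omega> \<in> space M. N t \<omega> = 0} * indicator {0<..} t \<partial>lborel)"
proof -
  define S where "S \<omega> = (INF r\<in>{r\<in>\<rat>. 0 < r}. if 0 < N r \<omega> then ennreal r else \<top>)" for \<omega>
  have [measurable]: "S \<in> borel_measurable M"
    unfolding S_def by (intro borel_measurable_INF) (auto intro: countable_subset[OF _ countable_rat])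
  interpret pair_sigma_finite lborel M ..
  have S_eq: "sojourn_time N \<omega> = S \<omega>" if "\<forall>s t. 0 \<le> s \<and> s \<le> t \<longrightarrow> N s \<omega> \<le> N t \<omega>" for \<omega>
    unfolding S_def by (rule sojourn_time_rational) (use that in blast)
  have "AE \<omega> in M. sojourn_time N \<omega> = S \<omega>"
    using visits_path by eventually_elim (auto intro: S_eq)
  then have "(\<integral>\<^sup>+ \<omega>. sojourn_time N \<omega> \<partial>M) = (\<integral>\<^sup>+ \<omega>. S \<omega> \<partial>M)"
    by (rule nn_integral_cong_AE)
  also have "\<dots> = (\<integral>\<^sup>+ \<omega>. (\<integral>\<^sup>+ t. indicator {t. 0 < t \<and> ennreal t < S \<omega>} t \<partial>lborel) \<partial>M)"
    by (simp only: nn_integral_ennreal_below)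
  also have "\<dots> = (\<integral>\<^sup>+ t. (\<integral>\<^sup>+ \<omega>. indicator {t. 0 < t \<and> ennreal t < S \<omega>} t \<partial>M) \<partial>lborel)"
    by (intro Fubini') (simp add: indicator_def)
  also have "\<dots> = (\<integral>\<^sup>+ t. emeasure M {\<omega> \<in> space M. N t \<omega> = 0} * indicator {0<..} t \<partial>lborel)"
  proof (intro nn_integral_cong)
    fix t :: real
    show "(\<integral>\<^sup>+ \<omega>. indicator {t. 0 < t \<and> ennreal t < S \<omega>} t \<partial>M)
        = emeasure M {\<omega> \<in> space M. N t \<omega> = 0} * indicator {0<..} t"
    proof (cases "0 < t")
      case True
      have "AE \<omega> in M. ennreal t < S \<omega> \<longleftrightarrow> N t \<omega> = 0"
        using visits_path
      proof eventually_elim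
        case (elim \<omega>)
        then have "sojourn_time N \<omega> = S \<omega>" by (auto intro: S_eq)
        moreover have "ennreal t < sojourn_time N \<omega> \<longleftrightarrow> N t \<omega> = 0"
          using elim True by (intro less_sojourn_time_iff) auto
        ultimately show ?case by simp
      qed
      then have "(\<integral>\<^sup>+ \<omega>. indicator {t. 0 < t \<and> ennreal t < S \<omega>} t \<partial>M)
          = (\<integral>\<^sup>+ \<omega>. indicator {\<omega> \<in> space M. N t \<omega> = 0} \<omega> \<partial>M)"
        using True AE_space
        by (intro nn_integral_cong_AE) (auto simp: indicator_def elim!: eventually_elim2)
      then show ?thesis using True by simp
    qed simp
  qed
  finally show ?thesis .
qed

text \<open>
  The probability of no visit up to \<open>t\<close> is replaced by the mean of an explicit, jointly measurable
  function \<open>G\<close> of \<open>t\<close> and the holding times, to which Fubini applies; then time is integrated out on each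
  path, one holding time after the other, and the expectation is taken last.
\<close>

lemma nn_integral_sojourn_time_suminf:
  assumes e: "e \<in> {1, 2}" and pos: "\<mu> 1 > 0" "\<mu> 2 > 0" "q12 > 0" "q21 > 0"
  defines "env n \<equiv> (other_env ^^ n) e"
  defines "rate n \<equiv> exit_rate q12 q21 (env n)"
  shows "(\<integral>\<^sup>+ \<omega>. sojourn_time N \<omega> \<partial>M)
    = (\<Sum>n. ennreal ((\<Prod>k<n. rate k / (rate k + \<mu> (env k))) / (rate n + \<mu> (env n))))"
proof -
  obtain H where indep: "indep_vars (\<lambda>_. borel) H UNIV"
    and exponential: "\<And>n. distributed M lborel (H n) (\<lambda>x. ennreal (exponential_density (rate n) x))"
    and path: "AE \<omega> in M. \<forall>n. \<forall>t\<ge>0. (\<Sum>k<n. H k \<omega>) \<le> t \<and> t < (\<Sum>k<Suc n. H k \<omega>) \<longrightarrow> E t \<omega> = env n"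
    using environment unfolding alternating_environment_def rate_def env_def by blast
  have rate_pos: "0 < rate n" for n using pos by (simp add: rate_def exit_rate_def)
  interpret exponential_holding_times M H rate
    by unfold_locales (fact indep exponential rate_pos)+
  define a where "a n = \<mu> (env n)" for n
  have a_pos: "0 < a n" for n
    using other_env_funpow[OF e, of n] pos by (auto simp: a_def env_def)
  define T where "T n \<omega> = (\<Sum>k<n. H k \<omega>)" for n \<omega>
  have [measurable]: "T n \<in> borel_measurable M" for n unfolding T_def by measurable
  define B where "B n \<omega> = (\<Sum>k<n. a k * H k \<omega>)" for n \<omega>
  have [measurable]: "B n \<in> borel_measurable M" for n unfolding B_def by measurable
  define G where "G t \<omega> = (\<Sum>n. ennreal (exp (- (B n \<omega> + a n * (t - T n \<omega>))))
      * indicator {T n \<omega>..<T n \<omega> + H n \<omega>} t)" for t \<omega>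
  have good: "AE \<omega> in M. sojourn_path (\<lambda>k. H k \<omega>) (\<lambda>u. \<mu> (E u \<omega>)) a"
  proof -
    have "rate k \<le> max q12 q21" for k by (simp add: rate_def exit_rate_def)
    from AE_unbounded[OF this] AE_H_pos path show ?thesis
    proof eventually_elim
      case (elim \<omega>)
      show ?case
      proof
        show "\<exists>n. t < (\<Sum>k<n. H k \<omega>)" for t using elim(1) by blast
        show "\<mu> (E u \<omega>) = a n"
          if "0 \<le> u" "(\<Sum>k<n. H k \<omega>) \<le> u" "u < (\<Sum>k<Suc n. H k \<omega>)" for n u
          using elim(3) that unfolding a_def by metis
      qed (use elim(2) a_pos in auto)
    qed
  qed
  interpret pair_sigma_finite lborel M ..
  have "(\<integral>\<^sup>+ \<omega>. sojourn_time N \<omega> \<partial>M) = (\<integral>\<^sup>+ t. (\<integral>\<^sup>+ \<omega>. G t \<omega> * indicator {0<..} t \<partial>M) \<partial>lborel)"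
    unfolding nn_integral_sojourn_time
  proof (intro nn_integral_cong)
    fix t :: real
    show "emeasure M {\<omega> \<in> space M. N t \<omega> = 0} * indicator {0<..} t = (\<integral>\<^sup>+ \<omega>. G t \<omega> * indicator {0<..} t \<partial>M)"
    proof (cases "0 < t")
      case True
      have "AE \<omega> in M. ennreal (pmf (poisson_pmf (cumulative_intensity \<mu> E 0 t \<omega>)) 0) = G t \<omega>"
        using good
      proof eventually_elim
        case (elim \<omega>)
        then interpret path: sojourn_path "\<lambda>k. H k \<omega>" "\<lambda>u. \<mu> (E u \<omega>)" a .
        show ?case
          using path.integral_pos[OF True] path.exp_integral_eq_suminf[of t] True
          by (simp add: cumulative_intensity_def G_def B_def T_def path.T_def)
      qed
      then show ?thesis
        using True by (simp add: emeasure_no_visit nn_integral_cong_AE)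
    qed simp
  qed
  also have "\<dots> = (\<integral>\<^sup>+ \<omega>. (\<integral>\<^sup>+ t. G t \<omega> * indicator {0<..} t \<partial>lborel) \<partial>M)"
    unfolding G_def indicator_def by (intro Fubini'[symmetric]) simp
  also have "\<dots> = (\<integral>\<^sup>+ \<omega>. (\<Sum>n. ennreal ((exp (- B n \<omega>) - exp (- B (Suc n) \<omega>)) / a n)) \<partial>M)"
  proof (intro nn_integral_cong_AE)
    show "AE \<omega> in M. (\<integral>\<^sup>+ t. G t \<omega> * indicator {0<..} t \<partial>lborel)
        = (\<Sum>n. ennreal ((exp (- B n \<omega>) - exp (- B (Suc n) \<omega>)) / a n))"
      using good
    proof eventually_elim
      case (elim \<omega>)
      then interpret path: sojourn_path "\<lambda>k. H k \<omega>" "\<lambda>u. \<mu> (E u \<omega>)" a .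
      have T: "0 \<le> T n \<omega>" for n using path.T_nonneg by (simp add: T_def path.T_def)
      \<comment> \<open>\<open>G\<close> already vanishes at negative times, so restricting it to \<open>t > 0\<close> changes it at most at \<open>0\<close>\<close>
      have "AE t in lborel. G t \<omega> * indicator {0<..} t = G t \<omega>"
        using AE_lborel_singleton[of "0::real"]
      proof eventually_elim
        case (elim t)
        have "G t \<omega> = 0" if "t < 0"
        proof -
          have "t \<notin> {T n \<omega>..<T n \<omega> + H n \<omega>}" for n
            using T[of n] that by simp
          then show ?thesis by (simp add: G_def del: atLeastLessThan_iff)
        qed
        with elim show ?case by (auto simp: indicator_def)
      qed
      then have "(\<integral>\<^sup>+ t. G t \<omega> * indicator {0<..} t \<partial>lborel) = (\<integral>\<^sup>+ t. G t \<omega> \<partial>lborel)"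
        by (rule nn_integral_cong_AE)
      also have "\<dots> = (\<Sum>n. \<integral>\<^sup>+ t. ennreal (exp (- (B n \<omega> + a n * (t - T n \<omega>))))
          * indicator {T n \<omega>..<T n \<omega> + H n \<omega>} t \<partial>lborel)"
        unfolding G_def by (intro nn_integral_suminf) measurable
      also have "\<dots> = (\<Sum>n. ennreal ((exp (- B n \<omega>) - exp (- (B n \<omega> + a n * H n \<omega>))) / a n))"
        by (simp only: nn_integral_exp_interval[OF a_pos less_imp_le[OF path.h_pos]])
      finally show ?case by (simp add: B_def)
    qed
  qed
  also have "\<dots> = (\<Sum>n. \<integral>\<^sup>+ \<omega>. ennreal ((exp (- B n \<omega>) - exp (- B (Suc n) \<omega>)) / a n) \<partial>M)"
    by (intro nn_integral_suminf) simp
  also have "\<dots> = (\<Sum>n. ennreal ((\<Prod>k<n. rate k / (rate k + a k)) / (rate n + a n)))"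
    unfolding B_def by (simp only: expected_increment[of a, OF a_pos])
  finally show ?thesis by (simp add: a_def)
qed

text \<open>
  The candidate \<open>m\<close> solves the first-step equation (\<open>one_step\<close>), which makes the series telescope. The
  remainder vanishes because \<open>P n\<close> decays geometrically: \<open>r / (r + \<mu>)\<close> takes only two values, both
  below \<open>1\<close>.
\<close>

lemma mean_sojourn_time_eq:
  assumes e: "e \<in> {1, 2}" and pos: "\<mu> 1 > 0" "\<mu> 2 > 0" "q12 > 0" "q21 > 0"
  shows "mean_sojourn_time M N = (\<mu> (other_env e) + q12 + q21) / (\<mu> 1 * \<mu> 2 + \<mu> 1 * q21 + \<mu> 2 * q12)"
proof -
  define D where "D = \<mu> 1 * \<mu> 2 + \<mu> 1 * q21 + \<mu> 2 * q12"
  define m where "m i = (\<mu> (other_env i) + q12 + q21) / D" for i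
  define env where "env n = (other_env ^^ n) e" for n
  define rate where "rate n = exit_rate q12 q21 (env n)" for n
  define P where "P n = (\<Prod>k<n. rate k / (rate k + \<mu> (env k)))" for n
  have D: "0 < D" using pos by (simp add: D_def add_pos_pos)
  have env: "env n = 1 \<or> env n = 2" for n
    using other_env_funpow[OF e, of n] by (auto simp: env_def)
  have rate: "0 < rate n" "0 < rate n + \<mu> (env n)" for n
    using env[of n] pos by (auto simp: rate_def exit_rate_def add_pos_pos)
  have P_nonneg: "0 \<le> P n" for n
    unfolding P_def using rate by (intro prod_nonneg) (simp add: less_imp_le)
  have one_step: "(rate n + \<mu> (env n)) * m (env n) = 1 + rate n * m (env (Suc n))" for n
  proof -
    have "env (Suc n) = other_env (env n)" by (simp add: env_def)
    then show ?thesis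
      using env[of n] D
      by (auto simp: m_def rate_def exit_rate_def other_env_def field_simps) (auto simp: D_def algebra_simps)
  qed
  have "P n / (rate n + \<mu> (env n)) = P n * m (env n) - P (Suc n) * m (env (Suc n))" for n
  proof -
    define x where "x = rate n + \<mu> (env n)"
    have "P n = P n / x * x" "P (Suc n) = P n / x * rate n"
      using rate[of n] by (simp_all add: P_def x_def)
    then have "P n * m (env n) - P (Suc n) * m (env (Suc n))
        = P n / x * (x * m (env n) - rate n * m (env (Suc n)))"
      by (metis mult.assoc right_diff_distrib)
    also have "x * m (env n) - rate n * m (env (Suc n)) = 1"
      using one_step[of n] by (simp add: x_def)
    finally show ?thesis by (simp add: x_def)
  qed
  moreover have "(\<lambda>n. P n * m (env n)) \<longlonglongrightarrow> 0"
  proof -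
    define c where "c = max (q12 / (q12 + \<mu> 1)) (q21 / (q21 + \<mu> 2))"
    define K where "K = max (m 1) (m 2)"
    have c: "0 \<le> c" "c < 1" using pos by (auto simp: c_def le_max_iff_disj)
    have m: "0 \<le> m (env n)" "m (env n) \<le> K" for n
      using env[of n] pos D by (auto simp: K_def m_def other_env_def)
    have "P n \<le> (\<Prod>k<n. c)" for n
      unfolding P_def
    proof (intro prod_mono conjI)
      fix k
      show "0 \<le> rate k / (rate k + \<mu> (env k))" using rate[of k] by simp
      show "rate k / (rate k + \<mu> (env k)) \<le> c"
        using env[of k] by (auto simp: rate_def exit_rate_def c_def)
    qed
    then have "P n * m (env n) \<le> c ^ n * K" for n
      using m[of n] P_nonneg[of n] c by (intro mult_mono) auto
    moreover have "(\<lambda>n. c ^ n * K) \<longlonglongrightarrow> 0"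
      using c by (intro tendsto_mult_left_zero LIMSEQ_power_zero) auto
    ultimately show ?thesis
      by - (rule tendsto_sandwich[where f = "\<lambda>_. 0" and h = "\<lambda>n. c ^ n * K"],
            simp_all add: m P_nonneg)
  qed
  ultimately have sums: "(\<lambda>n. P n / (rate n + \<mu> (env n))) sums (m e)"
    using telescope_sums'[of "\<lambda>n. P n * m (env n)" 0] by (simp add: P_def env_def)
  have "(\<integral>\<^sup>+ \<omega>. sojourn_time N \<omega> \<partial>M) = (\<Sum>n. ennreal (P n / (rate n + \<mu> (env n))))"
    unfolding nn_integral_sojourn_time_suminf[OF e pos] P_def rate_def env_def ..
  also have "\<dots> = ennreal (m e)"
    using rate P_nonneg by (intro suminf_ennreal_eq sums) (simp add: less_imp_le)
  finally show ?thesis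
    using D pos e by (auto simp: mean_sojourn_time_def m_def D_def other_env_def)
qed

end

section \<open>Dominant strategies\<close>

lemma dominant_linear:
  assumes "\<And>q r. U q r = q * (x::real)"
  shows "dominant U s \<longleftrightarrow> s \<in> {0..1} \<and> (x < 0 \<longrightarrow> s = 0) \<and> (x > 0 \<longrightarrow> s = 1)"
proof -
  have "(0::real) \<in> {0..1}" by simp
  then have "dominant U s \<longleftrightarrow> s \<in> {0..1} \<and> (\<forall>s'\<in>{0..1}. s' * x \<le> s * x)"
    unfolding dominant_def assms by blast
  also have "\<dots> \<longleftrightarrow> s \<in> {0..1} \<and> (x < 0 \<longrightarrow> s = 0) \<and> (x > 0 \<longrightarrow> s = 1)"
  proof (cases x "0::real" rule: linorder_cases)
    case less
    then have "(\<forall>s'\<in>{0..1}. s' * x \<le> s * x) \<longleftrightarrow> (\<forall>s'\<in>{0..1}. s \<le> s')" by simp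
    also have "\<dots> \<longleftrightarrow> s \<le> 0" by (metis atLeastAtMost_iff order_refl order_trans zero_le_one)
    finally show ?thesis using less by auto
  next
    case equal
    then show ?thesis by simp
  next
    case greater
    then have "(\<forall>s'\<in>{0..1}. s' * x \<le> s * x) \<longleftrightarrow> (\<forall>s'\<in>{0..1}. s' \<le> s)" by simp
    also have "\<dots> \<longleftrightarrow> 1 \<le> s" by (metis atLeastAtMost_iff order_refl order_trans zero_le_one)
    finally show ?thesis using greater by auto
  qed
  finally show ?thesis .
qed

theorem theorem3p1:
  fixes lam \<mu> :: "nat \<Rightarrow> real" and q12 q21 R C :: real
    and M :: "nat \<Rightarrow> 'a measure"
    and E N :: "nat \<Rightarrow> real \<Rightarrow> 'a \<Rightarrow> nat"
    and U :: "real \<Rightarrow> real \<Rightarrow> real"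
  assumes "lam 1 > 0" "lam 2 > 0" "\<mu> 1 > 0" "\<mu> 2 > 0" "q12 > 0" "q21 > 0" "R > 0" "C > 0"
    and "\<And>e. e \<in> {1, 2} \<Longrightarrow> visit_process (M e) q12 q21 \<mu> e (E e) (N e)"
  defines "U \<equiv> payoff lam q12 q21 R C (\<lambda>e. mean_sojourn_time (M e) (N e))"
  shows "(\<exists>q. dominant U q) \<and>
         (R / C < V_fu lam \<mu> q12 q21 \<longrightarrow> {q. dominant U q} = {0}) \<and>
         (R / C = V_fu lam \<mu> q12 q21 \<longrightarrow> {q. dominant U q} = {0..1}) \<and>
         (R / C > V_fu lam \<mu> q12 q21 \<longrightarrow> {q. dominant U q} = {1})"
proof -
  define D where "D = \<mu> 1 * \<mu> 2 + \<mu> 1 * q21 + \<mu> 2 * q12"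
  define L where "L = lam 1 * q21 + lam 2 * q12"
  have D: "0 < D" and L: "0 < L"
    using assms(1-6) by (simp_all add: D_def L_def add_pos_pos)
  have ES: "mean_sojourn_time (M e) (N e) = (\<mu> (other_env e) + q12 + q21) / D" if "e \<in> {1, 2}" for e
    using visit_process.mean_sojourn_time_eq[OF assms(9)[OF that] that] assms(3-6) by (simp add: D_def)
  have pL: "lam 1 * p_env q12 q21 1 + lam 2 * p_env q12 q21 2 = L / (q12 + q21)"
    by (simp add: p_env_def L_def add_divide_distrib)
  have p: "p_arrival lam q12 q21 1 = lam 1 * q21 / L" "p_arrival lam q12 q21 2 = lam 2 * q12 / L"
    unfolding p_arrival_def pL using assms(5,6) L by (simp_all add: p_env_def)
  have "(\<Sum>e\<in>{1, 2}. p_arrival lam q12 q21 e * (R - C * mean_sojourn_time (M e) (N e)))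
      = R - C * V_fu lam \<mu> q12 q21"
    using D L unfolding V_fu_def D_def[symmetric] L_def[symmetric]
    by (simp add: ES p[unfolded One_nat_def] other_env_def divide_simps) (simp add: L_def algebra_simps)
  then have U: "U q r = q * (R - C * V_fu lam \<mu> q12 q21)" for q r
    by (simp only: U_def payoff_def)
  have sign: "R - C * V_fu lam \<mu> q12 q21 < 0 \<longleftrightarrow> R / C < V_fu lam \<mu> q12 q21"
      "R - C * V_fu lam \<mu> q12 q21 > 0 \<longleftrightarrow> R / C > V_fu lam \<mu> q12 q21"
    using \<open>C > 0\<close> by (auto simp: field_simps)
  have dominant_iff: "dominant U s \<longleftrightarrow> s \<in> {0..1} \<and>
      (R / C < V_fu lam \<mu> q12 q21 \<longrightarrow> s = 0) \<and> (R / C > V_fu lam \<mu> q12 q21 \<longrightarrow> s = 1)" for s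
    using dominant_linear[OF U] unfolding sign .
  show ?thesis
  proof (intro conjI impI)
    show "\<exists>q. dominant U q"
      unfolding dominant_iff
      by (rule exI[of _ "if R / C > V_fu lam \<mu> q12 q21 then 1 else 0"]) auto
  qed (auto simp: dominant_iff)
qed

end
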